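(* Let $A\in\mathbb{C}^{3\times 3}$ have eigenvalues $\lambda_1,\lambda_2,\lambda_3$ and suppose $t_1(A)\ne 0$. Put $$\chi:=\operatorname{tr}A-\frac{t_2(A)}{t_1(A)} .$$ Then the curve $\det(p(A))=0$ satisfies $$p(\lambda_1)\,p(\lambda_2)\,p(\lambda_3)=\frac{t_1(A)}{4}\,p(\chi),$$ i.e. this equality holds for all $p,\theta\in\mathbb{R}$ with $\det(p(A))=0$. Moreover $\chi\in W(A)$.
   Context: For real parameters $p,\theta$ (pedal coordinate with respect to the origin and tangential angle of an oriented line) and $a\in\mathbb{C}$, $p(a):=p+\operatorname{Im}(e^{-i\theta}a)=p+\cos\theta\,\operatorname{Im}a-\sin\theta\,\operatorname{Re}a$. For a matrix $A$, $p(A):=pI+\cos\theta\,\operatorname{Im}A-\sin\theta\,\operatorname{Re}A$, where $\operatorname{Re}A=\frac{A+A^\star}{2}$, $\operatorname{Im}A=\frac{A-A^\star}{2i}$. The number $t_k(A):=\operatorname{tr}(A^kA^\star)-\sum_{j}\lambda_j^k\bar\lambda_j$, where $\lambda_j$ are the eigenvalues of $A$ with multiplicity. The numerical range is $W(A)=\{u^\star Au/u^\star u: u\in\mathbb{C}^3\setminus\{0\}\}$. *)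

theory Defs
  imports
    "Jordan_Normal_Form.Char_Poly"
    "Jordan_Normal_Form.Schur_Decomposition"
    "HOL-Computational_Algebra.Computational_Algebra"
begin

definition mat_trace :: "complex mat \<Rightarrow> complex" where
  "mat_trace A = (\<Sum>i<dim_row A. A $$ (i, i))"

definition eigenvalues :: "complex mat \<Rightarrow> complex multiset" where
  "eigenvalues A = proots (char_poly A)"

definition mat_Re :: "complex mat \<Rightarrow> complex mat" where
  "mat_Re A = (1 / 2) \<cdot>\<^sub>m (A + mat_adjoint A)"

definition mat_Im :: "complex mat \<Rightarrow> complex mat" where
  "mat_Im A = (1 / (2 * \<i>)) \<cdot>\<^sub>m (A - mat_adjoint A)"

definition pedal :: "real \<Rightarrow> real \<Rightarrow> complex \<Rightarrow> real" where
  "pedal p \<theta> a = p + Im (exp (- \<i> * complex_of_real \<theta>) * a)"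

definition mat_pedal :: "real \<Rightarrow> real \<Rightarrow> complex mat \<Rightarrow> complex mat" where
  "mat_pedal p \<theta> A =
     complex_of_real p \<cdot>\<^sub>m 1\<^sub>m (dim_row A)
       + complex_of_real (cos \<theta>) \<cdot>\<^sub>m mat_Im A - complex_of_real (sin \<theta>) \<cdot>\<^sub>m mat_Re A"

definition t_num :: "nat \<Rightarrow> complex mat \<Rightarrow> complex" where
  "t_num k A = mat_trace (A ^\<^sub>m k * mat_adjoint A) - (\<Sum>z\<in>#eigenvalues A. z ^ k * cnj z)"

text \<open>Since \<open>v \<bullet>c w\<close> conjugates its second argument, \<open>(A *\<^sub>v u) \<bullet>c u\<close> is
  \<open>u\<^sup>\<star> A u\<close>.\<close>

definition numerical_range :: "complex mat \<Rightarrow> complex set" where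
  "numerical_range A =
     {((A *\<^sub>v u) \<bullet>c u) / (u \<bullet>c u) | u. u \<in> carrier_vec (dim_row A) \<and> u \<noteq> 0\<^sub>v (dim_row A)}"

lemma pedal_eq: "pedal p \<theta> a = p + cos \<theta> * Im a - sin \<theta> * Re a"
  by (simp add: pedal_def Re_exp Im_exp)

end

theory Submission
  imports Defs
begin

text \<open>A unitary change of basis alters neither \<open>t\<^sub>k\<close> nor \<open>det p(A)\<close> nor the numerical range, so by
  Schur's theorem \<open>A\<close> may be taken upper triangular with diagonal \<open>\<lambda>\<^sub>1, \<lambda>\<^sub>2, \<lambda>\<^sub>3\<close>. Writing
  \<open>a, b, c\<close> for the entries at positions 12, 13, 23, one finds
  \<open>t\<^sub>1 = |a|\<^sup>2 + |b|\<^sup>2 + |c|\<^sup>2\<close> and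
  \<open>t\<^sub>1 \<chi> = \<lambda>\<^sub>3 |a|\<^sup>2 + \<lambda>\<^sub>2 |b|\<^sup>2 + \<lambda>\<^sub>1 |c|\<^sup>2 - a c cnj b\<close>. The Hermitian matrix \<open>p(A)\<close> has
  diagonal \<open>p(\<lambda>\<^sub>j)\<close> and off-diagonal entries \<open>m a, m b, m c\<close> with \<open>m = - \<i> e\<^sup>-\<^sup>\<i>\<^sup>\<theta> / 2\<close>, whose determinant
  expands to \<open>p(\<lambda>\<^sub>1) p(\<lambda>\<^sub>2) p(\<lambda>\<^sub>3) - t\<^sub>1 p(\<chi>) / 4\<close>. Finally \<open>\<chi>\<close> is the value of the Rayleigh
  quotient at the vector \<open>(cnj c, - cnj b, cnj a)\<close>.\<close>

no_notation fps_nth (infixl "$" 75)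

section \<open>Adjoints of complex matrices\<close>

lemma mat_adjoint_carrier [simp]:
  "A \<in> carrier_mat n m \<Longrightarrow> mat_adjoint A \<in> carrier_mat m n"
  by (auto simp: mat_adjoint_def mat_of_rows_def)

lemma dim_mat_adjoint [simp]:
  "dim_row (mat_adjoint A) = dim_col A" "dim_col (mat_adjoint A) = dim_row A"
  by (auto simp: mat_adjoint_def mat_of_rows_def)

lemma index_mat_adjoint [simp]:
  fixes A :: "complex mat"
  assumes "i < dim_col A" "j < dim_row A"
  shows "mat_adjoint A $$ (i, j) = cnj (A $$ (j, i))"
  using assms by (simp add: mat_adjoint_def mat_of_rows_def)

lemma mat_adjoint_mat_adjoint:
  fixes A :: "complex mat"
  shows "mat_adjoint (mat_adjoint A) = A"
  by (intro eq_matI) auto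

lemma mat_adjoint_mult:
  fixes A B :: "complex mat"
  assumes "A \<in> carrier_mat n m" "B \<in> carrier_mat m k"
  shows "mat_adjoint (A * B) = mat_adjoint B * mat_adjoint A"
  using assms by (intro eq_matI) (auto simp: scalar_prod_def mult.commute)

lemma mat_adjoint_four_block_one:
  fixes V :: "complex mat"
  assumes "V \<in> carrier_mat n n"
  shows "mat_adjoint (four_block_mat (1\<^sub>m 1) (0\<^sub>m 1 n) (0\<^sub>m n 1) V) =
         four_block_mat (1\<^sub>m 1) (0\<^sub>m 1 n) (0\<^sub>m n 1) (mat_adjoint V)"
  using assms by (intro eq_matI) (auto simp: four_block_mat_def Let_def)

section \<open>Unitary completion and Schur triangularization\<close>

lemma of_real_cmod_power2: "(complex_of_real (cmod z))\<^sup>2 = z * cnj z"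
  using complex_norm_square[of z] by simp

lemma cscalar_prod_self:
  fixes v :: "complex vec"
  shows "v \<bullet>c v = complex_of_real (\<Sum>i<dim_vec v. (cmod (v $ i))\<^sup>2)"
  by (simp add: scalar_prod_def of_real_cmod_power2 atLeast0LessThan)

text \<open>Gram-Schmidt keeps the head of its input list, so a basis starting with \<open>v\<close>
  yields an orthogonal basis starting with \<open>v\<close>. Dividing each member by its norm makes
  it orthonormal, and \<open>c\<close> records the rescaling of \<open>v\<close>.\<close>

lemma unitary_completion:
  fixes v :: "complex vec"
  assumes v: "v \<in> carrier_vec n" and v0: "v \<noteq> 0\<^sub>v n"
  obtains W c where "W \<in> carrier_mat n n" "mat_adjoint W * W = 1\<^sub>m n" "col W 0 = c \<cdot>\<^sub>v v"
proof -
  interpret cof_vec_space n "TYPE(complex)" .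
  define b where "b = basis_completion v"
  define ws where "ws = gram_schmidt n b"
  note b = basis_completion[OF v v0, folded b_def]
  have n: "n \<noteq> 0" using v v0 by auto
  from b(6,7) n obtain vs where bv: "b = v # vs" by (cases b) auto
  from gram_schmidt_result[OF b(2) b(4) b(5) refl, folded ws_def]
  have ws: "set ws \<subseteq> carrier_vec n" "corthogonal ws" "length ws = n"
    by (auto simp: b)
  have hdws: "hd ws = v"
    using gram_schmidt_hd[OF v, of vs, folded bv] unfolding ws_def .
  have wi: "ws ! i \<in> carrier_vec n" if "i < n" for i using ws that by auto
  \<comment> \<open>\<open>d i\<close> is the reciprocal of the norm of \<open>ws ! i\<close>. It is
    real, so conjugation leaves it fixed and it factors out of the inner products below.\<close>
  define d where "d i = complex_of_real (inverse (sqrt (\<Sum>k<n. (cmod (ws ! i $ k))\<^sup>2)))" for i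
  define us where "us = map (\<lambda>i. d i \<cdot>\<^sub>v ws ! i) [0..<n]"
  define W where "W = mat_of_cols n us"
  have W: "W \<in> carrier_mat n n" by (simp add: W_def us_def mat_of_cols_def)
  have colW: "col W i = d i \<cdot>\<^sub>v ws ! i" if "i < n" for i
    using wi[OF that] that by (simp add: W_def us_def)
  have unit: "mat_adjoint W * W = 1\<^sub>m n"
  proof (rule eq_matI)
    fix i j assume ij: "i < dim_row (1\<^sub>m n)" "j < dim_col (1\<^sub>m n)"
    have "(mat_adjoint W * W) $$ (i, j) = (\<Sum>k<n. cnj (W $$ (k, i)) * W $$ (k, j))"
      using W ij by (simp add: scalar_prod_def atLeast0LessThan)
    also have "\<dots> = (\<Sum>k<n. cnj (col W i $ k) * col W j $ k)"
      using W ij by (intro sum.cong) auto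
    also have "\<dots> = (\<Sum>k<n. (d i * d j) * (ws ! j $ k * cnj (ws ! i $ k)))"
    proof (intro sum.cong refl)
      fix k assume "k \<in> {..<n}"
      then show "cnj (col W i $ k) * col W j $ k = (d i * d j) * (ws ! j $ k * cnj (ws ! i $ k))"
        using ij wi[of i] wi[of j] by (simp add: colW) (simp add: d_def)
    qed
    also have "\<dots> = d i * d j * (ws ! j \<bullet>c ws ! i)"
      using wi[of i] ij by (simp add: scalar_prod_def sum_distrib_left atLeast0LessThan)
    also have "\<dots> = 1\<^sub>m n $$ (i, j)"
    proof (cases "i = j")
      case True
      let ?s = "\<Sum>k<n. (cmod (ws ! i $ k))\<^sup>2"
      have s: "ws ! i \<bullet>c ws ! i = complex_of_real ?s"
        using wi[of i] ij by (simp add: cscalar_prod_self)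
      \<comment> \<open>\<open>corthogonal\<close> says that the product vanishes exactly for
        distinct indices, so it also makes every squared norm nonzero.\<close>
      have "ws ! i \<bullet>c ws ! i \<noteq> 0" using corthogonalD[OF ws(2), of i i] ij ws(3) by auto
      then have "?s \<noteq> 0" using s by (metis of_real_0)
      moreover have "?s \<ge> 0" by (intro sum_nonneg) auto
      ultimately have "?s > 0" by linarith
      then have "inverse (sqrt ?s) * inverse (sqrt ?s) * ?s = 1"
        by (simp add: field_simps)
      then have "d i * d i * complex_of_real ?s = 1"
        unfolding d_def of_real_mult[symmetric] by simp
      then show ?thesis using True s ij by simp
    next
      case False
      then have "ws ! j \<bullet>c ws ! i = 0" using corthogonalD[OF ws(2), of j i] ij ws(3) by auto
      then show ?thesis using False ij by simp
    qed
    finally show "(mat_adjoint W * W) $$ (i, j) = 1\<^sub>m n $$ (i, j)" .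
  qed (use W in auto)
  have "col W 0 = d 0 \<cdot>\<^sub>v v"
    using colW[of 0] hdws n ws(3) by (cases ws) auto
  with W unit show ?thesis by (rule that)
qed

text \<open>Deflation: a unitary matrix whose first column is an eigenvector for the head of
  \<open>es\<close> splits off that eigenvalue, and the induction hypothesis handles the remaining
  block. Having \<open>mat_adjoint U\<close> as the inverse is what makes \<open>U\<close> unitary;
  the order of \<open>es\<close> is kept on the diagonal.\<close>

lemma unitary_schur_decomposition:
  fixes A :: "complex mat"
  assumes "A \<in> carrier_mat n n" "char_poly A = (\<Prod>e\<leftarrow>es. [:- e, 1:])"
  shows "\<exists>T U. similar_mat_wit A T U (mat_adjoint U) \<and> upper_triangular T \<and> diag_mat T = es"
  using assms
proof (induction es arbitrary: n A)
  case Nil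
  \<comment> \<open>The empty product has degree 0, and the degree of the characteristic polynomial
    is the dimension.\<close>
  then have "A \<in> carrier_mat 0 0" using degree_monic_char_poly[of A n] by auto
  moreover have "mat_adjoint (1\<^sub>m 0 :: complex mat) = 1\<^sub>m 0" by (intro eq_matI) auto
  ultimately show ?case
    using similar_mat_wit_refl[of A 0]
    by (intro exI[of _ A] exI[of _ "1\<^sub>m 0"]) (auto simp: diag_mat_def)
next
  case (Cons e es)
  note A = Cons.prems(1)
  have cp: "char_poly A = [:- e, 1:] * (\<Prod>e\<leftarrow>es. [:- e, 1:])" using Cons.prems(2) by simp
  have mon: "monic (\<Prod>e\<leftarrow>es. [:- e, 1:])" by (rule monic_prod_list) auto
  have "degree (char_poly A) = Suc (degree (\<Prod>e\<leftarrow>es. [:- e, 1:]))"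
    unfolding cp by (subst degree_mult_eq) (use mon in auto)
  with degree_monic_char_poly[OF A] obtain m where n: "n = Suc m" by (cases n) auto
  have "eigenvalue A e" unfolding eigenvalue_root_char_poly[OF A] cp by simp
  then obtain v where v: "v \<in> carrier_vec n" "v \<noteq> 0\<^sub>v n" and ev: "A *\<^sub>v v = e \<cdot>\<^sub>v v"
    using A unfolding eigenvalue_def eigenvector_def by auto
  obtain W c where W: "W \<in> carrier_mat n n" and WW: "mat_adjoint W * W = 1\<^sub>m n"
    and W0: "col W 0 = c \<cdot>\<^sub>v v"
    using unitary_completion[OF v] .
  have W': "mat_adjoint W \<in> carrier_mat n n" using W by simp
  have WW': "W * mat_adjoint W = 1\<^sub>m n" using mat_mult_left_right_inverse[OF W' W WW] .
  define B where "B = mat_adjoint W * A * W"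
  have B: "B \<in> carrier_mat n n" using W W' A by (auto simp: B_def)
  have BA: "similar_mat_wit B A (mat_adjoint W) W"
    by (rule similar_mat_witI[of _ _ n]) (use W W' A B WW WW' in \<open>auto simp: B_def\<close>)
  have AB: "similar_mat_wit A B W (mat_adjoint W)" using similar_mat_wit_sym[OF BA] .
  \<comment> \<open>\<open>A\<close> scales \<open>col W 0\<close> by \<open>e\<close>, and
    \<open>mat_adjoint W\<close> sends that column to the first unit vector. Hence the first column
    of \<open>B\<close> vanishes below its top entry \<open>e\<close>.\<close>
  have "col B 0 = mat_adjoint W *\<^sub>v (A *\<^sub>v col W 0)"
  proof -
    have "B = mat_adjoint W * (A * W)" unfolding B_def using W W' A by (intro assoc_mult_mat) auto
    moreover have "col (mat_adjoint W * (A * W)) 0 = mat_adjoint W *\<^sub>v col (A * W) 0"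
      using W W' A n by (intro col_mult2) auto
    moreover have "col (A * W) 0 = A *\<^sub>v col W 0" using W A n by (intro col_mult2) auto
    ultimately show ?thesis by simp
  qed
  also have "A *\<^sub>v col W 0 = e \<cdot>\<^sub>v col W 0"
    using A v ev by (simp add: W0 mult_mat_vec smult_smult_assoc mult.commute)
  also have "mat_adjoint W *\<^sub>v (e \<cdot>\<^sub>v col W 0) = e \<cdot>\<^sub>v (mat_adjoint W *\<^sub>v col W 0)"
    using W W' n by (intro mult_mat_vec) auto
  also have "mat_adjoint W *\<^sub>v col W 0 = col (1\<^sub>m n) 0"
    unfolding WW[symmetric] using W W' n by (intro col_mult2[symmetric]) auto
  finally have colB: "col B 0 = e \<cdot>\<^sub>v col (1\<^sub>m n) 0" .
  obtain B1 B2 B0 B3 where split: "split_block B 1 1 = (B1, B2, B0, B3)"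
    by (cases "split_block B 1 1") auto
  have "dim_row B = 1 + m" "dim_col B = 1 + m" using B n by auto
  note sb = split_block[OF split this]
  have Bij: "B $$ (i, 0) = (if i = 0 then e else 0)" if "i < n" for i
    using arg_cong[OF colB, of "\<lambda>v. v $ i"] that B n by auto
  have B1: "B1 = mat 1 1 (\<lambda>_. e)"
    using split Bij[of 0] n B by (intro eq_matI) (auto simp: split_block_def Let_def)
  have B0: "B0 = 0\<^sub>m m 1"
    using split Bij n B by (intro eq_matI) (auto simp: split_block_def Let_def)
  \<comment> \<open>The zero block makes the characteristic polynomial factor; cancelling the factor
    of \<open>e\<close> leaves the eigenvalues \<open>es\<close> for \<open>B3\<close>.\<close>
  have "char_poly B = char_poly B1 * char_poly B3"
    unfolding sb(5) B0 by (rule char_poly_four_block_zeros_col[OF sb(1,2,4)])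
  moreover have "char_poly B1 = [:- e, 1:]"
    by (simp add: B1 char_poly_defs det_def sign_def)
  moreover have "char_poly B = char_poly A"
    using BA by (intro char_poly_similar) (auto simp: similar_mat_def)
  ultimately have "char_poly B3 = (\<Prod>e\<leftarrow>es. [:- e, 1:])"
    using cp by (metis mult_cancel_left pCons_eq_0_iff zero_neq_one)
  from Cons.IH[OF sb(4) this] obtain T V where
    TV: "similar_mat_wit B3 T V (mat_adjoint V)" "upper_triangular T" "diag_mat T = es" by blast
  from similar_mat_witD2[OF sb(4) TV(1)]
  have T: "T \<in> carrier_mat m m" and V: "V \<in> carrier_mat m m" and VV: "V * mat_adjoint V = 1\<^sub>m m"
    by auto
  have V': "mat_adjoint V \<in> carrier_mat m m" using V by simp
  \<comment> \<open>\<open>P\<close> fixes the first basis vector and acts as \<open>V\<close> on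
    the rest. The upper right block of \<open>S\<close> has to be \<open>B2 * V\<close>, since
    conjugating back multiplies it on the right by the adjoint of \<open>V\<close>.\<close>
  define P where "P = four_block_mat (1\<^sub>m 1) (0\<^sub>m 1 m) (0\<^sub>m m 1) V"
  define S where "S = four_block_mat B1 (B2 * V) B0 T"
  have P: "P \<in> carrier_mat n n" using V n by (auto simp: P_def)
  have P': "mat_adjoint P = four_block_mat (1\<^sub>m 1) (0\<^sub>m 1 m) (0\<^sub>m m 1) (mat_adjoint V)"
    unfolding P_def by (rule mat_adjoint_four_block_one[OF V])
  have "similar_mat_wit B S P (mat_adjoint P)"
    unfolding P' unfolding sb(5) S_def P_def
  proof (rule similar_mat_wit_four_block[OF similar_mat_wit_refl[OF sb(1)] TV(1) _ _ sb(1,4,3)])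
    have "B2 * V * mat_adjoint V = B2 * (V * mat_adjoint V)"
      using sb(2) V V' by (intro assoc_mult_mat) auto
    then have "B2 * V * mat_adjoint V = B2" using sb(2) VV by simp
    then show "B2 = 1\<^sub>m 1 * (B2 * V) * mat_adjoint V"
      using sb(2) V by (metis left_mult_one_mat mult_carrier_mat)
    show "B0 = V * B0 * 1\<^sub>m 1" using V by (simp add: B0)
  qed (use sb(2) V in auto)
  from similar_mat_wit_trans[OF AB this] have "similar_mat_wit A S (W * P) (mat_adjoint (W * P))"
    by (simp add: mat_adjoint_mult[OF W P])
  moreover have "upper_triangular S"
    unfolding S_def B0
    by (rule upper_triangular_four_block[OF sb(1) T _ TV(2)]) (auto simp: B1)
  moreover have "diag_mat S = e # es"
  proof -
    have "diag_mat B1 = [e]" by (simp add: B1 diag_mat_def)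
    then show ?thesis
      unfolding S_def using diag_four_block_mat[OF sb(1) T] TV(3) by simp
  qed
  ultimately show ?case by blast
qed

text \<open>Over the complex numbers the characteristic polynomial splits, and the product of its
  linear factors depends only on the multiset of roots. Any listing of the eigenvalues can therefore
  be fed to the Schur decomposition.\<close>

lemma char_poly_eq_prod_eigenvalues:
  assumes "A \<in> carrier_mat n n" "eigenvalues A = mset es"
  shows "char_poly A = (\<Prod>e\<leftarrow>es. [:- e, 1:])"
proof -
  obtain as where as: "char_poly A = (\<Prod>a\<leftarrow>as. [:- a, 1:])"
    using char_poly_factorized[OF assms(1)] by blast
  have "mset as = mset es"
  proof -
    have "proots (\<Prod>a\<leftarrow>as. [:- a, 1:]) = mset as"
    proof (induction as)
      case (Cons a as)
      have "monic (\<Prod>a\<leftarrow>as. [:- a, 1:])" by (rule monic_prod_list) auto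
      then have "(\<Prod>a\<leftarrow>as. [:- a, 1:]) \<noteq> 0" by auto
      then show ?case using Cons by (simp add: proots_mult del: mult_pCons_left)
    qed simp
    then show ?thesis using assms(2) as by (simp add: eigenvalues_def)
  qed
  then have "prod_mset (image_mset (\<lambda>e. [:- e, 1:]) (mset as)) =
             prod_mset (image_mset (\<lambda>e. [:- e, 1:]) (mset es))" by simp
  then show ?thesis using as by (simp flip: prod_mset_prod_list mset_map)
qed

section \<open>Invariance under unitary similarity\<close>

lemma mat_trace_mult_commute:
  assumes "A \<in> carrier_mat n m" "B \<in> carrier_mat m n"
  shows "mat_trace (A * B) = mat_trace (B * A)"
proof -
  have "mat_trace (A * B) = (\<Sum>i<n. \<Sum>j<m. A $$ (i, j) * B $$ (j, i))"
    using assms by (simp add: mat_trace_def scalar_prod_def atLeast0LessThan)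
  also have "\<dots> = (\<Sum>j<m. \<Sum>i<n. B $$ (j, i) * A $$ (i, j))"
    by (subst sum.swap) (simp add: mult.commute)
  also have "\<dots> = mat_trace (B * A)"
    using assms by (simp add: mat_trace_def scalar_prod_def atLeast0LessThan)
  finally show ?thesis .
qed

lemma mat_trace_similar:
  assumes "similar_mat_wit A B P Q"
  shows "mat_trace A = mat_trace B"
proof -
  define n where "n = dim_row A"
  note w = similar_mat_witD[OF n_def assms]
  have "mat_trace A = mat_trace (P * (B * Q))" using w by simp
  also have "\<dots> = mat_trace (B * Q * P)" using w by (intro mat_trace_mult_commute) auto
  also have "B * Q * P = B" using w by simp
  finally show ?thesis .
qed

text \<open>Both similarities share the pair \<open>P\<close>, \<open>Q\<close>, so the inner factor
  \<open>Q * P\<close> cancels; similarities with unrelated witnesses need not multiply.\<close>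

lemma similar_mat_wit_mult:
  assumes A: "similar_mat_wit A B P Q" and A': "similar_mat_wit A' B' P Q"
    and dim: "dim_row A = dim_row A'"
  shows "similar_mat_wit (A * A') (B * B') P Q"
proof -
  define n where "n = dim_row A"
  note w = similar_mat_witD[OF n_def A]
  have n': "n = dim_row A'" using dim n_def by simp
  note w' = similar_mat_witD[OF n' A']
  have BQ: "B * Q \<in> carrier_mat n n" and BQ': "B' * Q \<in> carrier_mat n n"
    using w w' by auto
  have "A * A' = P * (B * Q) * (P * (B' * Q))" using w w' by simp
  also have "\<dots> = P * (B * Q * (P * (B' * Q)))"
    using w(6) BQ BQ' by (intro assoc_mult_mat[of _ n n _ n _ n]) auto
  also have "B * Q * (P * (B' * Q)) = B * (Q * (P * (B' * Q)))"
    using w BQ' by (intro assoc_mult_mat[of _ n n _ n _ n]) auto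
  also have "Q * (P * (B' * Q)) = Q * P * (B' * Q)"
    using w BQ' by (intro assoc_mult_mat[symmetric, of _ n n _ n _ n]) auto
  also have "\<dots> = B' * Q" unfolding w(2) using BQ' by (rule left_mult_one_mat)
  also have "B * (B' * Q) = B * B' * Q"
    using w w' by (intro assoc_mult_mat[symmetric, of _ n n _ n _ n]) auto
  also have "P * (B * B' * Q) = P * (B * B') * Q"
    using w w' by (intro assoc_mult_mat[symmetric, of _ n n _ n _ n]) auto
  finally show ?thesis
    using w w' by (intro similar_mat_witI[of _ _ n]) auto
qed

lemma similar_mat_wit_add:
  assumes A: "similar_mat_wit A B P Q" and A': "similar_mat_wit A' B' P Q"
    and dim: "dim_row A = dim_row A'"
  shows "similar_mat_wit (A + A') (B + B') P Q"
proof -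
  define n where "n = dim_row A"
  note w = similar_mat_witD[OF n_def A]
  have n': "n = dim_row A'" using dim n_def by simp
  note w' = similar_mat_witD[OF n' A']
  have "P * (B + B') * Q = (P * B + P * B') * Q"
    using w w' by (simp add: mult_add_distrib_mat)
  also have "\<dots> = P * B * Q + P * B' * Q"
    using w w' by (intro add_mult_distrib_mat) auto
  finally show ?thesis
    using w w' by (intro similar_mat_witI[of _ _ n]) auto
qed

text \<open>Here unitarity enters: taking adjoints swaps the outer factors \<open>U\<close> and
  \<open>mat_adjoint U\<close> and turns each into the other, so the witness pair is
  preserved.\<close>

lemma similar_mat_wit_adjoint:
  fixes A :: "complex mat"
  assumes "similar_mat_wit A B U (mat_adjoint U)"
  shows "similar_mat_wit (mat_adjoint A) (mat_adjoint B) U (mat_adjoint U)"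
proof -
  define n where "n = dim_row A"
  note w = similar_mat_witD[OF n_def assms]
  have "mat_adjoint A = mat_adjoint (U * B * mat_adjoint U)" using w(3) by simp
  also have "\<dots> = mat_adjoint (mat_adjoint U) * mat_adjoint (U * B)"
    using w by (intro mat_adjoint_mult[of _ n n _ n]) auto
  also have "\<dots> = U * (mat_adjoint B * mat_adjoint U)"
    using w by (simp add: mat_adjoint_mult[of U n n B n] mat_adjoint_mat_adjoint)
  also have "\<dots> = U * mat_adjoint B * mat_adjoint U"
    using w by (intro assoc_mult_mat[symmetric]) auto
  finally show ?thesis
    using w by (intro similar_mat_witI[of _ _ n]) auto
qed

lemma eigenvalues_similar:
  assumes "similar_mat_wit A B P Q"
  shows "eigenvalues A = eigenvalues B"
proof -
  have "similar_mat A B" using assms unfolding similar_mat_def by blast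
  then show ?thesis unfolding eigenvalues_def by (simp only: char_poly_similar[of A B])
qed

lemma t_num_unitary_similar:
  assumes "similar_mat_wit A T U (mat_adjoint U)"
  shows "t_num k A = t_num k T"
proof -
  define n where "n = dim_row A"
  note w = similar_mat_witD[OF n_def assms]
  have "dim_row (A ^\<^sub>m k) = dim_row (mat_adjoint A)" using w(4) by auto
  then have "similar_mat_wit (A ^\<^sub>m k * mat_adjoint A) (T ^\<^sub>m k * mat_adjoint T) U (mat_adjoint U)"
    by (intro similar_mat_wit_mult similar_mat_wit_pow similar_mat_wit_adjoint assms)
  from mat_trace_similar[OF this] show ?thesis
    by (simp only: t_num_def eigenvalues_similar[OF assms])
qed

text \<open>This is Im w = (w - cnj w) / (2 i) applied to exp(-i \<theta>) \<open>A\<close>. It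
  builds the pedal matrix from the identity, \<open>A\<close> and its adjoint by sums and scalar
  multiples, all of which respect a common unitary similarity.\<close>

lemma mat_pedal_altdef:
  fixes p \<theta> :: real
  assumes "A \<in> carrier_mat n n"
  defines "m \<equiv> - \<i> / 2 * exp (- \<i> * complex_of_real \<theta>)"
  shows "mat_pedal p \<theta> A = complex_of_real p \<cdot>\<^sub>m 1\<^sub>m n + (m \<cdot>\<^sub>m A + cnj m \<cdot>\<^sub>m mat_adjoint A)"
proof -
  have m: "m = - \<i> / 2 * cos \<theta> - sin \<theta> / 2"
    by (auto simp: m_def complex_eq_iff Re_exp Im_exp)
  show ?thesis
    using assms(1) unfolding m
    by (intro eq_matI) (auto simp: mat_pedal_def mat_Re_def mat_Im_def field_simps)
qed

lemma det_mat_pedal_unitary_similar: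
  assumes "similar_mat_wit A T U (mat_adjoint U)"
  shows "det (mat_pedal p \<theta> A) = det (mat_pedal p \<theta> T)"
proof -
  define n where "n = dim_row A"
  note w = similar_mat_witD[OF n_def assms]
  have "similar_mat_wit (1\<^sub>m n) (1\<^sub>m n) U (mat_adjoint U)"
    using w by (intro similar_mat_witI[of _ _ n]) auto
  then have "similar_mat_wit (mat_pedal p \<theta> A) (mat_pedal p \<theta> T) U (mat_adjoint U)"
    unfolding mat_pedal_altdef[OF w(4)] mat_pedal_altdef[OF w(5)] using w
    by (intro similar_mat_wit_add similar_mat_wit_smult similar_mat_wit_adjoint assms) auto
  then show ?thesis by (intro det_similar) (auto simp: similar_mat_def)
qed

text \<open>A vector \<open>u\<close> for \<open>T\<close> corresponds to
  \<open>U *\<^sub>v u\<close> for \<open>A\<close> with the same Rayleigh quotient, because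
  \<open>U\<close> preserves inner products. This direction carries \<chi> from \<open>T\<close>
  back to \<open>A\<close>.\<close>

lemma numerical_range_unitary_similar:
  assumes "similar_mat_wit A T U (mat_adjoint U)"
  shows "numerical_range T \<subseteq> numerical_range A"
proof
  define n where "n = dim_row A"
  note w = similar_mat_witD[OF n_def assms]
  fix z assume "z \<in> numerical_range T"
  then obtain u where z: "z = ((T *\<^sub>v u) \<bullet>c u) / (u \<bullet>c u)" and u: "u \<in> carrier_vec n" "u \<noteq> 0\<^sub>v n"
    using w(5) by (auto simp: numerical_range_def)
  \<comment> \<open>Interchanging two finite sums moves \<open>U\<close> across the inner product as
    its adjoint, which then cancels against the other \<open>U\<close>.\<close>
  have iso: "(U *\<^sub>v x) \<bullet>c (U *\<^sub>v y) = x \<bullet>c y" if "x \<in> carrier_vec n" "y \<in> carrier_vec n" for x y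
  proof -
    have "(U *\<^sub>v x) \<bullet>c (U *\<^sub>v y) = (mat_adjoint U *\<^sub>v (U *\<^sub>v x)) \<bullet>c y"
    proof -
      have "(U *\<^sub>v x) \<bullet>c (U *\<^sub>v y) = (\<Sum>i<n. \<Sum>j<n. (U *\<^sub>v x) $ i * cnj (U $$ (i, j)) * cnj (y $ j))"
        using that w(6) by (simp add: scalar_prod_def atLeast0LessThan sum_distrib_left mult.assoc)
      also have "\<dots> = (\<Sum>j<n. \<Sum>i<n. (U *\<^sub>v x) $ i * cnj (U $$ (i, j)) * cnj (y $ j))"
        by (rule sum.swap)
      also have "\<dots> = (mat_adjoint U *\<^sub>v (U *\<^sub>v x)) \<bullet>c y"
        using that w(6) by (simp add: scalar_prod_def atLeast0LessThan sum_distrib_left sum_distrib_right mult_ac)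
      finally show ?thesis .
    qed
    also have "mat_adjoint U *\<^sub>v (U *\<^sub>v x) = x"
      using assoc_mult_mat_vec[OF w(7,6) that(1)] w(2) that(1) by simp
    finally show ?thesis .
  qed
  have "A *\<^sub>v (U *\<^sub>v u) = U *\<^sub>v (T *\<^sub>v u)"
  proof -
    have "A * U = U * T * (mat_adjoint U * U)"
      unfolding w(3) using w by (intro assoc_mult_mat[of _ n n _ n _ n]) auto
    also have "\<dots> = U * T" using w by simp
    finally have "A * U = U * T" .
    then show ?thesis
      using assoc_mult_mat_vec[OF w(4,6) u(1)] assoc_mult_mat_vec[OF w(6,5) u(1)] by simp
  qed
  then have "z = ((A *\<^sub>v (U *\<^sub>v u)) \<bullet>c (U *\<^sub>v u)) / ((U *\<^sub>v u) \<bullet>c (U *\<^sub>v u))"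
    using w u by (simp add: z iso)
  moreover have "U *\<^sub>v u \<noteq> 0\<^sub>v n"
  proof
    assume "U *\<^sub>v u = 0\<^sub>v n"
    then have "u \<bullet>c u = 0" using iso[of u u] u by simp
    then show False using u by simp
  qed
  ultimately show "z \<in> numerical_range A"
    using w u by (auto simp: numerical_range_def n_def[symmetric])
qed

section \<open>Explicit computations for triangular matrices of size 3\<close>

lemma det_3:
  fixes A :: "complex mat"
  assumes A: "A \<in> carrier_mat 3 3"
  shows "det A = A $$ (0,0) * (A $$ (1,1) * A $$ (2,2) - A $$ (1,2) * A $$ (2,1))
               - A $$ (0,1) * (A $$ (1,0) * A $$ (2,2) - A $$ (1,2) * A $$ (2,0))
               + A $$ (0,2) * (A $$ (1,0) * A $$ (2,1) - A $$ (1,1) * A $$ (2,0))"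
proof -
  have det2: "det B = B $$ (0,0) * B $$ (1,1) - B $$ (0,1) * B $$ (1,0)"
    if B: "B \<in> carrier_mat 2 2" for B :: "complex mat"
    using B by (subst laplace_expansion_row[OF B, of 0])
      (auto simp: cofactor_def mat_delete_def det_single eval_nat_numeral)
  have 1: "mat_delete A 0 j \<in> carrier_mat 2 2" for j
    using A by (auto simp: mat_delete_def)
  show ?thesis
    using A by (subst laplace_expansion_row[OF A, of 0])
      (auto simp: cofactor_def det2[OF 1], auto simp: mat_delete_def eval_nat_numeral algebra_simps)
qed

text \<open>In the Leibniz expansion each transposition contributes minus |m|^2 times a squared
  modulus times the remaining diagonal pedal. The two 3-cycles are conjugate and add up to |m|^2
  times the imaginary part.\<close>

lemma det_mat_pedal_triangular_3:
  fixes p \<theta> :: real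
  assumes T: "T \<in> carrier_mat 3 3" "upper_triangular T"
  defines "a \<equiv> T $$ (0,1)" and "b \<equiv> T $$ (0,2)" and "c \<equiv> T $$ (1,2)"
  shows "det (mat_pedal p \<theta> T) = complex_of_real (
     pedal p \<theta> (T $$ (0,0)) * pedal p \<theta> (T $$ (1,1)) * pedal p \<theta> (T $$ (2,2))
     - ((cmod c)\<^sup>2 * pedal p \<theta> (T $$ (0,0)) + (cmod b)\<^sup>2 * pedal p \<theta> (T $$ (1,1))
        + (cmod a)\<^sup>2 * pedal p \<theta> (T $$ (2,2))
        - Im (exp (- \<i> * complex_of_real \<theta>) * (a * c * cnj b))) / 4)"
proof -
  define e where "e = exp (- \<i> * complex_of_real \<theta>)"
  define m where "m = - \<i> / 2 * e"
  define P where "P z = complex_of_real (pedal p \<theta> z)" for z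
  have ee: "e * cnj e = 1"
    by (simp add: e_def flip: of_real_cmod_power2)
  \<comment> \<open>Since |e| = 1, the modulus of \<open>m\<close> is 1/2; this is the origin of the
    factor 1/4 in the theorem.\<close>
  have mm: "m * cnj m = 1 / 4" using ee by (simp add: m_def algebra_simps)
  have low: "T $$ (Suc 0, 0) = 0" "T $$ (2, 0) = 0" "T $$ (2, Suc 0) = 0"
    using T by (auto intro!: upper_triangularD[OF T(2)])
  have im: "complex_of_real (Im z) = - \<i> / 2 * z + \<i> / 2 * cnj z" for z
    by (simp add: complex_eq_iff)
  have Pm: "P z = p + m * z + cnj m * cnj z" for z
  proof -
    have "P z = p + complex_of_real (Im (e * z))"
      by (simp only: P_def pedal_def e_def of_real_add)
    then show ?thesis unfolding im by (simp add: m_def mult.assoc)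
  qed
  let ?M = "mat_pedal p \<theta> T"
  note M = mat_pedal_altdef[OF T(1), of p \<theta>, folded e_def, folded m_def]
  have carr: "?M \<in> carrier_mat 3 3" using T unfolding M by auto
  have ij: "?M $$ (i, j) = (if i = j then p else 0) + m * T $$ (i, j) + cnj m * cnj (T $$ (j, i))"
    if "i < 3" "j < 3" for i j
    using that T unfolding M by auto
  have "det ?M = P (T $$ (0,0)) * (P (T $$ (1,1)) * P (T $$ (2,2)) - m * cnj m * (c * cnj c))
     - m * a * (cnj m * cnj a * P (T $$ (2,2)) - m * c * (cnj m * cnj b))
     + m * b * (cnj m * cnj a * (cnj m * cnj c) - P (T $$ (1,1)) * (cnj m * cnj b))"
    unfolding det_3[OF carr] by (simp add: ij low Pm) (simp add: a_def b_def c_def)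
  also have "\<dots> = P (T $$ (0,0)) * P (T $$ (1,1)) * P (T $$ (2,2))
     - m * cnj m * ((c * cnj c) * P (T $$ (0,0)) + (b * cnj b) * P (T $$ (1,1)) + (a * cnj a) * P (T $$ (2,2))
         - (m * (a * c * cnj b) + cnj m * cnj (a * c * cnj b)))"
    by (simp add: algebra_simps)
  also have "m * (a * c * cnj b) + cnj m * cnj (a * c * cnj b) = Im (e * (a * c * cnj b))"
    unfolding im by (simp add: m_def mult.assoc)
  finally show ?thesis
    by (simp add: mm P_def e_def of_real_cmod_power2)
qed

text \<open>The trace pairs corresponding entries of the power and of \<open>T\<close>, and the
  diagonal terms cancel against the eigenvalue sum. An entry of the square above the diagonal is
  that of \<open>T\<close> times the sum of its two eigenvalues, with the extra term
  \<open>a * c\<close> in the corner.\<close>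

lemma t_num_triangular_3:
  assumes T: "T \<in> carrier_mat 3 3" "upper_triangular T"
    and ev: "eigenvalues T = {#T $$ (0,0), T $$ (1,1), T $$ (2,2)#}"
  defines "a \<equiv> T $$ (0,1)" and "b \<equiv> T $$ (0,2)" and "c \<equiv> T $$ (1,2)"
  shows "t_num 1 T = complex_of_real ((cmod a)\<^sup>2 + (cmod b)\<^sup>2 + (cmod c)\<^sup>2)"
    and "t_num 2 T = (T $$ (0,0) + T $$ (1,1)) * (cmod a)\<^sup>2 + (T $$ (0,0) + T $$ (2,2)) * (cmod b)\<^sup>2
           + (T $$ (1,1) + T $$ (2,2)) * (cmod c)\<^sup>2 + a * c * cnj b"
proof -
  have low: "T $$ (Suc 0, 0) = 0" "T $$ (2, 0) = 0" "T $$ (2, Suc 0) = 0"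
    using T by (auto intro!: upper_triangularD[OF T(2)])
  have sum3: "(\<Sum>i<3. f i) = f 0 + f 1 + f 2" for f :: "nat \<Rightarrow> complex"
    by (simp add: eval_nat_numeral)
  have tr: "mat_trace (B * mat_adjoint T) = (\<Sum>i<3. \<Sum>j<3. B $$ (i,j) * cnj (T $$ (i,j)))"
    if "B \<in> carrier_mat 3 3" for B
    using that T(1) by (simp add: mat_trace_def scalar_prod_def atLeast0LessThan)
  show "t_num 1 T = complex_of_real ((cmod a)\<^sup>2 + (cmod b)\<^sup>2 + (cmod c)\<^sup>2)"
    using T(1)
    by (simp add: t_num_def ev tr sum3 low a_def b_def c_def of_real_cmod_power2)
  have TT: "(T * T) $$ (i,j) = (\<Sum>k<3. T $$ (i,k) * T $$ (k,j))" if "i < 3" "j < 3" for i j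
    using that T(1) by (simp add: scalar_prod_def atLeast0LessThan)
  have pow: "T ^\<^sub>m 2 = T * T" using T(1) by (simp add: eval_nat_numeral)
  have "mat_trace (T ^\<^sub>m 2 * mat_adjoint T) = (\<Sum>i<3. \<Sum>j<3. (T * T) $$ (i,j) * cnj (T $$ (i,j)))"
    unfolding pow using T(1) by (intro tr) auto
  then show "t_num 2 T = (T $$ (0,0) + T $$ (1,1)) * (cmod a)\<^sup>2 + (T $$ (0,0) + T $$ (2,2)) * (cmod b)\<^sup>2
           + (T $$ (1,1) + T $$ (2,2)) * (cmod c)\<^sup>2 + a * c * cnj b"
    unfolding t_num_def ev
    by (simp add: sum3 TT low a_def b_def c_def of_real_cmod_power2 algebra_simps
        power2_eq_square[of "T $$ ij" for ij] del: index_mult_mat)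
qed

lemma triangular_3_numerical_range:
  assumes T: "T \<in> carrier_mat 3 3" "upper_triangular T"
  defines "a \<equiv> T $$ (0,1)" and "b \<equiv> T $$ (0,2)" and "c \<equiv> T $$ (1,2)"
  assumes nz: "(cmod a)\<^sup>2 + (cmod b)\<^sup>2 + (cmod c)\<^sup>2 \<noteq> 0"
  shows "(T $$ (2,2) * (cmod a)\<^sup>2 + T $$ (1,1) * (cmod b)\<^sup>2 + T $$ (0,0) * (cmod c)\<^sup>2 - a * c * cnj b)
          / ((cmod a)\<^sup>2 + (cmod b)\<^sup>2 + (cmod c)\<^sup>2) \<in> numerical_range T"
proof -
  \<comment> \<open>The moduli put the weights |c|^2, |b|^2, |a|^2 on the diagonal entries in order.
    The conjugations and the sign make the two cross terms in b c cnj a cancel, leaving only - a c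
    cnj b.\<close>
  define u where "u = vec 3 (\<lambda>i. [cnj c, - cnj b, cnj a] ! i)"
  have u: "u \<in> carrier_vec 3" by (simp add: u_def)
  have ui: "u $ 0 = cnj c" "u $ Suc 0 = - cnj b" "u $ 2 = cnj a"
    by (simp_all add: u_def)
  have low: "T $$ (Suc 0, 0) = 0" "T $$ (2, 0) = 0" "T $$ (2, Suc 0) = 0"
    using T by (auto intro!: upper_triangularD[OF T(2)])
  have sum3: "(\<Sum>i<3. f i) = f 0 + f 1 + f 2" for f :: "nat \<Rightarrow> complex"
    by (simp add: eval_nat_numeral)
  have uu: "u \<bullet>c u = complex_of_real ((cmod a)\<^sup>2 + (cmod b)\<^sup>2 + (cmod c)\<^sup>2)"
    using u by (simp add: scalar_prod_def atLeast0LessThan sum3 ui of_real_cmod_power2)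
  have "(T *\<^sub>v u) \<bullet>c u = (\<Sum>i<3. (\<Sum>j<3. T $$ (i,j) * u $ j) * cnj (u $ i))"
    using u T(1) by (simp add: scalar_prod_def atLeast0LessThan)
  also have "\<dots> = T $$ (2,2) * (cmod a)\<^sup>2 + T $$ (1,1) * (cmod b)\<^sup>2 + T $$ (0,0) * (cmod c)\<^sup>2 - a * c * cnj b"
    by (simp add: sum3 ui low a_def b_def c_def of_real_cmod_power2 algebra_simps)
  finally have Tu: "(T *\<^sub>v u) \<bullet>c u = \<dots>" .
  have "u \<noteq> 0\<^sub>v 3"
  proof
    assume "u = 0\<^sub>v 3"
    then have "u \<bullet>c u = 0" by simp
    then show False using nz unfolding uu of_real_eq_0_iff by blast
  qed
  moreover have "dim_row T = 3" using T(1) by simp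
  ultimately have "((T *\<^sub>v u) \<bullet>c u) / (u \<bullet>c u) \<in> numerical_range T"
    using u unfolding numerical_range_def by (intro CollectI exI[of _ u] conjI refl) simp_all
  then show ?thesis unfolding Tu uu by simp
qed

theorem corollary54:
  fixes A :: "complex mat" and l1 l2 l3 \<chi> :: complex
  assumes "A \<in> carrier_mat 3 3"
    and "eigenvalues A = {#l1, l2, l3#}"
    and "t_num 1 A \<noteq> 0"
    and "\<chi> = mat_trace A - t_num 2 A / t_num 1 A"
  shows "(\<forall>p \<theta> :: real. det (mat_pedal p \<theta> A) = 0 \<longrightarrow>
            complex_of_real (pedal p \<theta> l1 * pedal p \<theta> l2 * pedal p \<theta> l3)
              = t_num 1 A / 4 * complex_of_real (pedal p \<theta> \<chi>))
         \<and> \<chi> \<in> numerical_range A"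
proof -
  have "char_poly A = (\<Prod>e\<leftarrow>[l1, l2, l3]. [:- e, 1:])"
    using assms(1,2) by (intro char_poly_eq_prod_eigenvalues) auto
  from unitary_schur_decomposition[OF assms(1) this] obtain T U where
    AT: "similar_mat_wit A T U (mat_adjoint U)" and upper: "upper_triangular T"
    and diag: "diag_mat T = [l1, l2, l3]" by blast
  have T: "T \<in> carrier_mat 3 3" using similar_mat_witD2[OF assms(1) AT] by auto
  have l: "T $$ (0,0) = l1" "T $$ (1,1) = l2" "T $$ (2,2) = l3"
    using diag T by (auto simp: diag_mat_def eval_nat_numeral)
  have "eigenvalues T = {#l1, l2, l3#}"
    using eigenvalues_similar[OF AT] assms(2) by simp
  then have ev: "eigenvalues T = {#T $$ (0,0), T $$ (1,1), T $$ (2,2)#}" by (simp only: l)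
  define a where "a = T $$ (0,1)"
  define b where "b = T $$ (0,2)"
  define c where "c = T $$ (1,2)"
  define r where "r = (cmod a)\<^sup>2 + (cmod b)\<^sup>2 + (cmod c)\<^sup>2"
  note t = t_num_triangular_3[OF T upper ev, folded t_num_unitary_similar[OF AT] a_def b_def c_def,
      unfolded l]
  have t1: "t_num 1 A = complex_of_real r" using t(1) by (simp add: r_def)
  have r: "r \<noteq> 0" using assms(3) t1 by auto
  have "mat_trace A = l1 + l2 + l3"
    using mat_trace_similar[OF AT] T l by (simp add: mat_trace_def eval_nat_numeral)
  \<comment> \<open>The coefficient of each squared modulus is the trace minus a sum of two
    eigenvalues, which is the third one.\<close>
  then have chi: "complex_of_real r * \<chi> =
      l3 * (cmod a)\<^sup>2 + l2 * (cmod b)\<^sup>2 + l1 * (cmod c)\<^sup>2 - a * c * cnj b"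
    using r unfolding assms(4) t1 t(2) by (simp add: field_simps) (simp add: r_def algebra_simps)
  show ?thesis
  proof (intro conjI allI impI)
    fix p \<theta> :: real
    assume det: "det (mat_pedal p \<theta> A) = 0"
    define e where "e = exp (- \<i> * complex_of_real \<theta>)"
    \<comment> \<open>A pedal is \<open>p\<close> plus a real-linear function, so the real factor
      \<open>r\<close> moves inside; then \<open>r * p\<close> is shared among the three pedals
      according to the summands of \<open>r\<close>. The result is the bracket in the determinant
      formula.\<close>
    have "r * pedal p \<theta> \<chi> = r * p + Im (e * (complex_of_real r * \<chi>))"
      by (simp add: pedal_def e_def algebra_simps)
    also have "\<dots> = (cmod c)\<^sup>2 * pedal p \<theta> l1 + (cmod b)\<^sup>2 * pedal p \<theta> l2
        + (cmod a)\<^sup>2 * pedal p \<theta> l3 - Im (e * (a * c * cnj b))"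
      unfolding chi by (simp add: pedal_def e_def r_def algebra_simps del: exp_minus)
    finally have "r * pedal p \<theta> \<chi> = \<dots>" .
    with det have "complex_of_real (pedal p \<theta> l1 * pedal p \<theta> l2 * pedal p \<theta> l3
        - r * pedal p \<theta> \<chi> / 4) = 0"
      unfolding det_mat_pedal_unitary_similar[OF AT] det_mat_pedal_triangular_3[OF T upper] l
      by (simp only: a_def b_def c_def e_def)
    then have eq: "pedal p \<theta> l1 * pedal p \<theta> l2 * pedal p \<theta> l3 = r / 4 * pedal p \<theta> \<chi>"
      unfolding of_real_eq_0_iff by simp
    show "complex_of_real (pedal p \<theta> l1 * pedal p \<theta> l2 * pedal p \<theta> l3)
        = t_num 1 A / 4 * complex_of_real (pedal p \<theta> \<chi>)"
      unfolding eq t1 by simp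
  next
    have "\<chi> = (complex_of_real r * \<chi>) / complex_of_real r" using r by simp
    also have "\<dots> \<in> numerical_range T"
      unfolding chi using triangular_3_numerical_range[OF T upper, folded a_def b_def c_def, unfolded l] r
      by (simp add: r_def)
    finally show "\<chi> \<in> numerical_range A"
      using numerical_range_unitary_similar[OF AT] by blast
  qed
qed

end
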